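(* The set of pairs $(\alpha,\beta)\in\mathbb{R}^2$ satisfying $$\liminf_{q\to+\infty}\, q\,(\log q)^2\,\|q\alpha\|\,\|q\beta\|>0$$ (where $q$ runs over positive integers) has Hausdorff dimension $2$.
   Context: For a real number $x$, $\|x\|$ denotes the distance from $x$ to the nearest integer. *)

theory Defs
  imports "HOL-Analysis.Analysis"
begin

definition nint_dist :: "real \<Rightarrow> real" where
  "nint_dist x = infdist x \<int>"

text \<open>delta-approximating s-dimensional Hausdorff content, via countable covers by
  bounded sets of diameter at most delta (finite covers are included by padding with
  empty sets).\<close>
definition hausdorff_content :: "real \<Rightarrow> real \<Rightarrow> 'a::metric_space set \<Rightarrow> ennreal" where
  "hausdorff_content s \<delta> E =
     (INF U \<in> {U :: nat \<Rightarrow> 'a set. (\<forall>i. bounded (U i) \<and> diameter (U i) \<le> \<delta>) \<and> E \<subseteq> (\<Union>i. U i)}.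
        (\<Sum>i. ennreal (diameter (U i) powr s)))"

definition hausdorff_measure :: "real \<Rightarrow> 'a::metric_space set \<Rightarrow> ennreal" where
  "hausdorff_measure s E = (SUP \<delta> \<in> {0<..}. hausdorff_content s \<delta> E)"

definition hausdorff_dim :: "'a::metric_space set \<Rightarrow> real" where
  "hausdorff_dim E = Inf {s. 0 \<le> s \<and> hausdorff_measure s E = 0}"

end

theory Submission
  imports Defs
begin

text \<open>
  This is a Peres--Schlag argument carried out with dyadic squares. The pairs \<open>(\<alpha>, \<beta>)\<close> for which
  the product is too small for some \<open>q\<close> in the range \<open>4^n \<le> log2 q < 4^(n+1)\<close> fill only a small constant
  proportion of every square of side at least \<open>1 / q\<close>: one logarithm is spent on the area of a
  hyperbolic region and one on the sum of \<open>1 / q\<close>. Hence at least half of the area survives every stage,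
  so the survivors of the \<open>n\<close>-th stage have area at least \<open>2^(-n)\<close>, whereas their scale decreases doubly
  exponentially. This leaves room to remove, in addition, the sets \<open>U i\<close> of a cover with
  \<open>\<Sum>i. diameter (U i) powr t\<close> small and \<open>t < 2\<close>, each one at the stage of its own scale: the total area
  removed in this way is at most a power of the scale. The point that remains in the
  end satisfies the Diophantine condition and lies outside the cover.
\<close>

section \<open>Hausdorff measure\<close>

lemma hausdorff_content_le_suminf:
  assumes "\<And>i. bounded (U i)" "\<And>i. diameter (U i) \<le> \<delta>" "E \<subseteq> (\<Union>i. U i)"
  shows "hausdorff_content s \<delta> E \<le> (\<Sum>i. ennreal (diameter (U i) powr s))"
  unfolding hausdorff_content_def using assms by (intro INF_lower) auto

lemma hausdorff_content_lessE:
  assumes "hausdorff_content s \<delta> E < e"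
  obtains U where "\<And>i. bounded (U i)" "\<And>i. diameter (U i) \<le> \<delta>" "E \<subseteq> (\<Union>i. U i)"
    "(\<Sum>i. ennreal (diameter (U i) powr s)) < e"
  using assms unfolding hausdorff_content_def INF_less_iff by blast

lemma hausdorff_content_mono:
  assumes "E \<subseteq> F"
  shows "hausdorff_content s \<delta> E \<le> hausdorff_content s \<delta> F"
  unfolding hausdorff_content_def using assms by (intro INF_superset_mono) auto

lemma hausdorff_content_le_card:
  assumes "finite I" "\<And>i. i \<in> I \<Longrightarrow> bounded (B i)" "\<And>i. i \<in> I \<Longrightarrow> diameter (B i) \<le> d"
    and "E \<subseteq> (\<Union>i\<in>I. B i)" "0 \<le> d" "d \<le> \<delta>" "0 \<le> s"
  shows "hausdorff_content s \<delta> E \<le> ennreal (real (card I) * d powr s)"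
proof -
  obtain f where f: "bij_betw f {..<card I} I"
    using ex_bij_betw_nat_finite[OF assms(1)] by (auto simp: atLeast0LessThan)
  define U where "U i = (if i < card I then B (f i) else {})" for i
  have f_mem: "f i \<in> I" if "i < card I" for i using bij_betwE[OF f] that by auto
  have U: "bounded (U i)" "diameter (U i) \<le> d" for i
    using assms f_mem by (auto simp: U_def)
  have "E \<subseteq> (\<Union>i. U i)"
  proof
    fix x assume "x \<in> E"
    then obtain j where "j \<in> I" "x \<in> B j" using assms(4) by blast
    moreover from \<open>j \<in> I\<close> have "j \<in> f ` {..<card I}"
      using f by (simp add: bij_betw_imp_surj_on)
    then obtain i where "i < card I" "j = f i" by auto
    ultimately have "x \<in> U i" by (simp add: U_def)
    then show "x \<in> (\<Union>i. U i)" by blast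
  qed
  then have "hausdorff_content s \<delta> E \<le> (\<Sum>i. ennreal (diameter (U i) powr s))"
    using U \<open>d \<le> \<delta>\<close> by (intro hausdorff_content_le_suminf) (auto intro: order_trans)
  also have "\<dots> = (\<Sum>i<card I. ennreal (diameter (U i) powr s))"
    by (rule suminf_finite) (auto simp: U_def)
  also have "\<dots> \<le> (\<Sum>i<card I. ennreal (d powr s))"
    using U \<open>0 \<le> s\<close> by (intro sum_mono ennreal_leI powr_mono2) (auto simp: diameter_ge_0)
  also have "\<dots> = ennreal (real (card I) * d powr s)"
    by (simp add: ennreal_mult ennreal_of_nat_eq_real_of_nat)
  finally show ?thesis .
qed

lemma hausdorff_content_UN_le_suminf:
  assumes "\<And>i j. bounded (U i j)" "\<And>i j. diameter (U i j) \<le> \<delta>" "\<And>i. A i \<subseteq> (\<Union>j. U i j)"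
  shows "hausdorff_content s \<delta> (\<Union>i. A i) \<le> (\<Sum>i. \<Sum>j. ennreal (diameter (U i j) powr s))"
proof -
  define W where "W = (\<lambda>(i, j). U i j)"
  have "(\<Union>i. A i) \<subseteq> (\<Union>k. W (prod_decode k))"
  proof
    fix x assume "x \<in> (\<Union>i. A i)"
    then obtain i j where "x \<in> U i j" using assms(3) by blast
    then have "x \<in> W (prod_decode (prod_encode (i, j)))" by (simp add: W_def)
    then show "x \<in> (\<Union>k. W (prod_decode k))" by blast
  qed
  then have "hausdorff_content s \<delta> (\<Union>i. A i) \<le> (\<Sum>k. ennreal (diameter (W (prod_decode k)) powr s))"
    using assms by (intro hausdorff_content_le_suminf) (auto simp: W_def split: prod.split)
  also have "\<dots> = (\<Sum>i. \<Sum>j. ennreal (diameter (U i j) powr s))"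
    by (rule suminf_ennreal_2dimen[of _ "\<lambda>p. ennreal (diameter (W p) powr s)"]) (simp add: W_def)
  finally show ?thesis .
qed

lemma hausdorff_content_UN_le:
  "hausdorff_content s \<delta> (\<Union>i. A i) \<le> (\<Sum>i. hausdorff_content s \<delta> (A i))"
proof (rule ennreal_le_epsilon)
  fix e :: real
  assume sum_finite: "(\<Sum>i. hausdorff_content s \<delta> (A i)) < top" and "0 < e"
  let ?e = "\<lambda>i. hausdorff_content s \<delta> (A i) + ennreal (e * (1 / 2) ^ Suc i)"
  have content_less: "hausdorff_content s \<delta> (A i) < ?e i" for i
  proof -
    have "hausdorff_content s \<delta> (A i) \<noteq> \<infinity>"
      using ennreal_suminf_lessD[OF sum_finite, of i] by simp
    moreover have "0 < ennreal (e * (1 / 2) ^ Suc i)"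
      using \<open>0 < e\<close> by simp
    ultimately show ?thesis
      using ennreal_add_left_cancel_less[of _ 0] by fastforce
  qed
  have "\<exists>U. (\<forall>j. bounded (U j) \<and> diameter (U j) \<le> \<delta>) \<and> A i \<subseteq> (\<Union>j. U j)
      \<and> (\<Sum>j. ennreal (diameter (U j) powr s)) < ?e i" for i
    using content_less[of i] by (rule hausdorff_content_lessE) blast
  then have "\<exists>U. \<forall>i. (\<forall>j. bounded (U i j) \<and> diameter (U i j) \<le> \<delta>) \<and> A i \<subseteq> (\<Union>j. U i j)
      \<and> (\<Sum>j. ennreal (diameter (U i j) powr s)) < ?e i"
    by (intro choice allI)
  then obtain U where U: "\<And>i j. bounded (U i j)" "\<And>i j. diameter (U i j) \<le> \<delta>"
      "\<And>i. A i \<subseteq> (\<Union>j. U i j)" "\<And>i. (\<Sum>j. ennreal (diameter (U i j) powr s)) < ?e i"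
    by blast
  have "hausdorff_content s \<delta> (\<Union>i. A i) \<le> (\<Sum>i. \<Sum>j. ennreal (diameter (U i j) powr s))"
    by (intro hausdorff_content_UN_le_suminf U)
  also have "\<dots> \<le> (\<Sum>i. ?e i)"
    using U(4) by (intro suminf_le summableI) (auto intro: less_imp_le)
  also have "\<dots> = (\<Sum>i. hausdorff_content s \<delta> (A i)) + (\<Sum>i. ennreal (e * (1 / 2) ^ Suc i))"
    by (intro suminf_add[symmetric] summableI)
  also have "(\<Sum>i. ennreal (e * (1 / 2) ^ Suc i)) = ennreal (e * 1)"
    using \<open>0 < e\<close> by (intro suminf_ennreal_eq sums_mult power_half_series) auto
  finally show "hausdorff_content s \<delta> (\<Union>i. A i) \<le> (\<Sum>i. hausdorff_content s \<delta> (A i)) + ennreal e"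
    by simp
qed

lemma hausdorff_measure_eq_0_iff:
  "hausdorff_measure s E = 0 \<longleftrightarrow> (\<forall>\<delta>>0. hausdorff_content s \<delta> E = 0)"
  by (auto simp: hausdorff_measure_def simp flip: bot_ennreal)

lemma hausdorff_measure_eq_0_subset:
  assumes "hausdorff_measure s F = 0" "E \<subseteq> F"
  shows "hausdorff_measure s E = 0"
  using assms hausdorff_content_mono[OF assms(2)] unfolding hausdorff_measure_eq_0_iff
  by (metis le_zero_eq)

lemma hausdorff_measure_UN_eq_0:
  assumes "\<And>i::nat. hausdorff_measure s (A i) = 0"
  shows "hausdorff_measure s (\<Union>i. A i) = 0"
  unfolding hausdorff_measure_eq_0_iff
proof (intro allI impI)
  fix \<delta> :: real assume "\<delta> > 0"
  then show "hausdorff_content s \<delta> (\<Union>i. A i) = 0"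
    using hausdorff_content_UN_le[of s \<delta> A] assms by (simp add: hausdorff_measure_eq_0_iff)
qed

lemma hausdorff_measure_eq_0_exponent_mono:
  assumes "hausdorff_measure s E = 0" "s \<le> t"
  shows "hausdorff_measure t E = 0"
  unfolding hausdorff_measure_eq_0_iff
proof (intro allI impI)
  fix \<delta> :: real assume "\<delta> > 0"
  have content_le: "hausdorff_content t \<delta> E \<le> ennreal e" if "0 < e" for e
  proof -
    have "hausdorff_content s (min \<delta> 1) E < ennreal e"
      using assms(1) \<open>\<delta> > 0\<close> that by (simp add: hausdorff_measure_eq_0_iff)
    then obtain U where U: "\<And>i. bounded (U i)" "\<And>i. diameter (U i) \<le> min \<delta> 1" "E \<subseteq> (\<Union>i. U i)"
        "(\<Sum>i. ennreal (diameter (U i) powr s)) < ennreal e"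
      by (rule hausdorff_content_lessE) blast
    have "hausdorff_content t \<delta> E \<le> (\<Sum>i. ennreal (diameter (U i) powr t))"
      using U by (intro hausdorff_content_le_suminf) auto
    also have "\<dots> \<le> (\<Sum>i. ennreal (diameter (U i) powr s))"
      using U \<open>s \<le> t\<close> by (intro suminf_le ennreal_leI powr_mono' summableI) (auto simp: diameter_ge_0)
    finally show ?thesis using U(4) by simp
  qed
  have "hausdorff_content t \<delta> E \<le> 0" by (rule ennreal_le_epsilon) (simp add: content_le)
  then show "hausdorff_content t \<delta> E = 0" by simp
qed

lemma suminf_ennreal_lessD:
  fixes f :: "nat \<Rightarrow> real"
  assumes "(\<Sum>i. ennreal (f i)) < ennreal e" "\<And>i. 0 \<le> f i"
  shows "summable f" "suminf f < e"
proof -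
  show "summable f" using assms by (intro summable_suminf_not_top) auto
  then have "0 \<le> suminf f" "(\<Sum>i. ennreal (f i)) = ennreal (suminf f)"
    using assms(2) by (auto intro: suminf_nonneg suminf_ennreal2)
  then show "suminf f < e" using assms(1) by (simp add: ennreal_less_iff)
qed

text \<open>The radii \<open>r i\<close> replace the diameters because these may vanish.\<close>

lemma hausdorff_measure_eq_0_coverE:
  assumes "hausdorff_measure t E = 0" "0 < t" "0 < \<delta>" "0 < e"
  obtains U :: "nat \<Rightarrow> 'a::metric_space set" and r :: "nat \<Rightarrow> real"
  where "E \<subseteq> (\<Union>i. U i)" "\<And>i. bounded (U i)" "\<And>i. diameter (U i) \<le> r i"
    "\<And>i. 0 < r i" "\<And>i. r i < \<delta>" "summable (\<lambda>i. r i powr t)" "(\<Sum>i. r i powr t) \<le> e"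
proof -
  have "hausdorff_content t (\<delta> / 2) E < ennreal (e / 2)"
    using assms by (simp add: hausdorff_measure_eq_0_iff)
  then obtain U where U: "\<And>i. bounded (U i)" "\<And>i. diameter (U i) \<le> \<delta> / 2" "E \<subseteq> (\<Union>i. U i)"
      and sum_less: "(\<Sum>i. ennreal (diameter (U i) powr t)) < ennreal (e / 2)"
    by (rule hausdorff_content_lessE) blast
  define \<rho> where "\<rho> i = e / 2 * (1 / 2) ^ Suc i" for i
  define \<eta> where "\<eta> i = min (\<delta> / 2) (\<rho> i powr (1 / t))" for i
  define r where "r i = max (diameter (U i)) (\<eta> i)" for i
  have \<rho>: "\<rho> sums (e / 2 * 1)" "\<rho> i > 0" for i
    unfolding \<rho>_def using \<open>0 < e\<close> by (intro sums_mult power_half_series, simp)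
  have \<eta>: "0 < \<eta> i" "\<eta> i < \<delta>" for i
    using \<rho>(2)[of i] \<open>0 < \<delta>\<close> by (auto simp: \<eta>_def)
  note diameters = suminf_ennreal_lessD[OF sum_less powr_ge_zero]
  have r_powr_le: "r i powr t \<le> diameter (U i) powr t + \<rho> i" for i
  proof -
    have "\<eta> i powr t \<le> (\<rho> i powr (1 / t)) powr t"
      using \<eta>(1)[of i] \<open>0 < t\<close> by (intro powr_mono2) (auto simp: \<eta>_def)
    also have "\<dots> = \<rho> i" using \<rho>(2)[of i] \<open>0 < t\<close> by (simp add: powr_powr)
    finally show ?thesis using \<rho>(2)[of i] by (simp add: r_def max_def add_increasing less_imp_le)
  qed
  have summable_bound: "summable (\<lambda>i. diameter (U i) powr t + \<rho> i)"
    by (intro summable_add diameters(1) sums_summable[OF \<rho>(1)])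
  have summable_r: "summable (\<lambda>i. r i powr t)"
    by (rule summable_comparison_test'[OF summable_bound, of 0]) (use r_powr_le in auto)
  have "(\<Sum>i. r i powr t) \<le> (\<Sum>i. diameter (U i) powr t + \<rho> i)"
    by (intro suminf_le r_powr_le summable_r summable_bound)
  also have "\<dots> = (\<Sum>i. diameter (U i) powr t) + e / 2"
    using suminf_add[OF diameters(1) sums_summable[OF \<rho>(1)]] sums_unique[OF \<rho>(1)] by simp
  finally have "(\<Sum>i. r i powr t) \<le> e" using diameters(2) by simp
  moreover have "0 < r i" "r i < \<delta>" "diameter (U i) \<le> r i" for i
    using \<eta>[of i] U(2)[of i] \<open>0 < \<delta>\<close> by (auto simp: r_def)
  ultimately show thesis using U summable_r by (intro that[of U r])
qed

lemma hausdorff_dim_eqI: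
  assumes "0 \<le> d"
    and null: "\<And>s. d < s \<Longrightarrow> hausdorff_measure s E = 0"
    and not_null: "\<And>s. 0 \<le> s \<Longrightarrow> s < d \<Longrightarrow> hausdorff_measure s E \<noteq> 0"
  shows "hausdorff_dim E = d"
  unfolding hausdorff_dim_def
proof (rule cInf_eq_non_empty)
  have "d + 1 \<in> {s. 0 \<le> s \<and> hausdorff_measure s E = 0}" using null[of "d + 1"] \<open>0 \<le> d\<close> by simp
  then show "{s. 0 \<le> s \<and> hausdorff_measure s E = 0} \<noteq> {}" by blast
  show "d \<le> s" if "s \<in> {s. 0 \<le> s \<and> hausdorff_measure s E = 0}" for s
    using that not_null[of s] by (cases "s < d") auto
  show "y \<le> d" if lower_bound: "\<And>s. s \<in> {s. 0 \<le> s \<and> hausdorff_measure s E = 0} \<Longrightarrow> y \<le> s" for y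
  proof (rule dense_ge)
    fix s assume "d < s"
    then show "y \<le> s" using lower_bound[of s] null[of s] \<open>0 \<le> d\<close> by simp
  qed
qed

section \<open>Upper bound in Euclidean spaces\<close>

definition cube :: "real \<Rightarrow> 'a::euclidean_space set" where
  "cube R = {x. \<forall>b\<in>Basis. \<bar>x \<bullet> b\<bar> \<le> R}"

definition grid_cell :: "real \<Rightarrow> ('a::euclidean_space \<Rightarrow> int) \<Rightarrow> 'a set" where
  "grid_cell h k = {x. \<forall>b\<in>Basis. \<lfloor>x \<bullet> b / h\<rfloor> = k b}"

lemma norm_diff_le_in_grid_cell:
  fixes x y :: "'a::euclidean_space" and h :: real
  assumes "h > 0" "x \<in> grid_cell h k" "y \<in> grid_cell h k"
  shows "norm (x - y) \<le> DIM('a) * h"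
proof -
  have "\<bar>(x - y) \<bullet> b\<bar> \<le> h" if "b \<in> Basis" for b
  proof -
    have "\<lfloor>x \<bullet> b / h\<rfloor> = \<lfloor>y \<bullet> b / h\<rfloor>" using assms that by (simp add: grid_cell_def)
    then have "\<bar>x \<bullet> b / h - y \<bullet> b / h\<bar> \<le> 1" by linarith
    then have "\<bar>(x - y) \<bullet> b / h\<bar> \<le> 1" by (simp add: inner_diff_left diff_divide_distrib)
    then show ?thesis using \<open>h > 0\<close> by simp
  qed
  then have "(\<Sum>b\<in>Basis. \<bar>(x - y) \<bullet> b\<bar>) \<le> DIM('a) * h"
    by (rule sum_bounded_above)
  then show ?thesis using norm_le_l1[of "x - y"] by linarith
qed

lemma bounded_grid_cell: "h > 0 \<Longrightarrow> bounded (grid_cell h k)"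
  unfolding bounded_two_points dist_norm using norm_diff_le_in_grid_cell by blast

lemma diameter_grid_cell_le:
  fixes k :: "'a::euclidean_space \<Rightarrow> int" and h :: real
  shows "h > 0 \<Longrightarrow> diameter (grid_cell h k) \<le> DIM('a) * h"
  by (intro diameter_le norm_diff_le_in_grid_cell) auto

lemma cube_subset_UN_grid_cells:
  assumes "h > 0" "R \<le> N * h"
  shows "cube R \<subseteq> (\<Union>k\<in>Basis \<rightarrow>\<^sub>E {- int N..int N}. grid_cell h k)"
proof
  fix x :: 'a assume x: "x \<in> cube R"
  define k where "k = restrict (\<lambda>b. \<lfloor>x \<bullet> b / h\<rfloor>) Basis"
  have "\<lfloor>x \<bullet> b / h\<rfloor> \<in> {- int N..int N}" if "b \<in> Basis" for b
  proof -
    have "\<bar>x \<bullet> b\<bar> \<le> N * h" using x that assms(2) by (force simp: cube_def)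
    then have "\<bar>x \<bullet> b / h\<bar> \<le> N" using assms(1) by (simp add: divide_le_eq)
    then show ?thesis by (simp add: le_floor_iff floor_le_iff abs_le_iff del: abs_divide)
  qed
  then have "k \<in> Basis \<rightarrow>\<^sub>E {- int N..int N}" by (auto simp: k_def)
  moreover have "x \<in> grid_cell h k" by (simp add: grid_cell_def k_def)
  ultimately show "x \<in> (\<Union>k\<in>Basis \<rightarrow>\<^sub>E {- int N..int N}. grid_cell h k)" by blast
qed

lemma hausdorff_content_cube_le:
  assumes "N > 0" "R > 0" "DIM('a) * (R / real N) \<le> \<delta>" "s \<ge> 0"
  shows "hausdorff_content s \<delta> (cube R :: 'a::euclidean_space set)
    \<le> ennreal ((3 * real N) ^ DIM('a) * (DIM('a) * (R / real N)) powr s)"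
proof -
  define h where "h = R / real N"
  let ?K = "(Basis :: 'a set) \<rightarrow>\<^sub>E {- int N..int N}"
  have "h > 0" "R \<le> N * h" using assms by (simp_all add: h_def)
  then have "hausdorff_content s \<delta> (cube R :: 'a set) \<le> ennreal (card ?K * (DIM('a) * h) powr s)"
    using assms
    by (intro hausdorff_content_le_card[where B = "grid_cell h"] cube_subset_UN_grid_cells
        bounded_grid_cell diameter_grid_cell_le) (simp_all add: h_def finite_PiE)
  also have "\<dots> \<le> ennreal ((3 * real N) ^ DIM('a) * (DIM('a) * h) powr s)"
  proof (intro ennreal_leI mult_right_mono)
    have "card {- int N..int N} = 2 * N + 1" by simp
    then have "card ?K = (2 * N + 1) ^ DIM('a)" by (simp only: card_PiE finite_Basis prod_constant)
    also have "\<dots> \<le> (3 * N) ^ DIM('a)" using \<open>N > 0\<close> by (intro power_mono) auto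
    finally have "real (card ?K) \<le> real ((3 * N) ^ DIM('a))" by (rule of_nat_mono)
    then show "card ?K \<le> (3 * real N) ^ DIM('a)" by simp
  qed simp
  finally show ?thesis unfolding h_def .
qed

lemma hausdorff_measure_cube_eq_0:
  fixes s :: real
  assumes dim_less: "DIM('a) < s" and "R > 0"
  shows "hausdorff_measure s (cube R :: 'a::euclidean_space set) = 0"
  unfolding hausdorff_measure_eq_0_iff
proof (intro allI impI)
  fix \<delta> :: real assume "\<delta> > 0"
  let ?C = "cube R :: 'a set"
  define D where "D = DIM('a) * R"
  have D_pos: "D > 0" using \<open>R > 0\<close> by (simp add: D_def)
  have "(\<lambda>N. real N powr (DIM('a) - s)) \<longlonglongrightarrow> 0"
    by (intro tendsto_neg_powr filterlim_real_sequentially) (use dim_less in simp)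
  then have "(\<lambda>N. 3 ^ DIM('a) * D powr s * real N powr (DIM('a) - s)) \<longlonglongrightarrow> 0"
    by (rule tendsto_mult_right_zero)
  then have bound_tendsto_0: "(\<lambda>N. ennreal (3 ^ DIM('a) * D powr s * real N powr (DIM('a) - s))) \<longlonglongrightarrow> 0"
    using tendsto_ennrealI by fastforce
  have "\<forall>\<^sub>F N in sequentially. D / real N < \<delta>"
    using lim_const_over_n[of D] \<open>\<delta> > 0\<close> by (rule order_tendstoD(2))
  then have "\<forall>\<^sub>F N in sequentially. hausdorff_content s \<delta> ?C
      \<le> ennreal (3 ^ DIM('a) * D powr s * real N powr (DIM('a) - s))"
    using eventually_gt_at_top[of 0]
  proof eventually_elim
    case (elim N)
    have "(3 * real N) ^ DIM('a) * (DIM('a) * (R / real N)) powr s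
        = 3 ^ DIM('a) * D powr s * real N powr (DIM('a) - s)"
      using elim D_pos by (simp add: D_def powr_divide powr_diff powr_realpow power_mult_distrib)
    moreover have "hausdorff_content s \<delta> ?C
        \<le> ennreal ((3 * real N) ^ DIM('a) * (DIM('a) * (R / real N)) powr s)"
      using elim dim_less \<open>R > 0\<close> by (intro hausdorff_content_cube_le) (auto simp: D_def)
    ultimately show ?case by (simp only:)
  qed
  then have "hausdorff_content s \<delta> ?C \<le> 0"
    by (intro tendsto_lowerbound[OF bound_tendsto_0]) auto
  then show "hausdorff_content s \<delta> ?C = 0" by simp
qed

theorem hausdorff_measure_eq_0_euclidean:
  fixes E :: "'a::euclidean_space set" and s :: real
  assumes "DIM('a) < s"
  shows "hausdorff_measure s E = 0"
proof (rule hausdorff_measure_eq_0_subset)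
  show "hausdorff_measure s (\<Union>n. cube (Suc n) :: 'a set) = 0"
    by (intro hausdorff_measure_UN_eq_0 hausdorff_measure_cube_eq_0 assms) simp
  show "E \<subseteq> (\<Union>n. cube (Suc n))"
  proof
    fix x :: 'a
    obtain n :: nat where "norm x \<le> n" using real_arch_simple by blast
    then have "\<bar>x \<bullet> b\<bar> \<le> Suc n" if "b \<in> Basis" for b
      using Basis_le_norm[OF that, of x] by simp
    then have "x \<in> cube (Suc n)" by (simp add: cube_def)
    then show "x \<in> (\<Union>n. cube (Suc n))" by blast
  qed
qed

section \<open>Grid squares\<close>

text \<open>Cells are closed, at the cost of overlaps, so that finite unions of squares are compact.\<close>

definition cell :: "real \<Rightarrow> nat \<Rightarrow> real set" where
  "cell h i = {real i * h .. (real i + 1) * h}"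

definition square :: "real \<Rightarrow> nat \<times> nat \<Rightarrow> (real \<times> real) set" where
  "square h c = cell h (fst c) \<times> cell h (snd c)"

definition cells_meeting :: "real \<Rightarrow> real set \<Rightarrow> nat set" where
  "cells_meeting h A = {i. cell h i \<inter> A \<noteq> {}}"

definition squares_meeting :: "real \<Rightarrow> (real \<times> real) set \<Rightarrow> (nat \<times> nat) set" where
  "squares_meeting h B = {c. square h c \<inter> B \<noteq> {}}"

definition ancestor :: "nat \<Rightarrow> nat \<times> nat \<Rightarrow> nat \<times> nat" where
  "ancestor M c = (fst c div M, snd c div M)"

definition meets_sparsely :: "real \<Rightarrow> real \<Rightarrow> nat \<Rightarrow> (real \<times> real) set \<Rightarrow> bool" where
  "meets_sparsely \<epsilon> h M B \<longleftrightarrow>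
     (\<forall>s. real (card {c \<in> squares_meeting h B. ancestor M c = s}) \<le> \<epsilon> * (real M)\<^sup>2)"

lemma card_le_sum_if_subset_UN:
  assumes "A \<subseteq> (\<Union>i\<in>I. B i)" "finite I" "\<And>i. i \<in> I \<Longrightarrow> finite (B i)"
  shows "real (card A) \<le> (\<Sum>i\<in>I. real (card (B i)))"
proof -
  have "card A \<le> card (\<Union>i\<in>I. B i)" using assms by (intro card_mono) auto
  also have "\<dots> \<le> (\<Sum>i\<in>I. card (B i))" by (rule card_UN_le[OF assms(2)])
  finally show ?thesis by (simp flip: of_nat_sum)
qed

lemma card_int_interval_le:
  fixes x y :: real
  assumes "x \<le> y"
  shows "real (card {\<lceil>x\<rceil>..\<lfloor>y\<rfloor>}) \<le> y - x + 1"
  using assms by simp linarith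

lemma
  assumes "h > 0" "x \<le> y"
  shows finite_cells_meeting_interval: "finite (cells_meeting h {x..y})"
    and card_cells_meeting_interval_le: "real (card (cells_meeting h {x..y})) \<le> (y - x) / h + 2"
proof -
  let ?P = "{\<lceil>x / h - 1\<rceil>..\<lfloor>y / h\<rfloor>}"
  have image_subset: "int ` cells_meeting h {x..y} \<subseteq> ?P"
  proof
    fix p assume "p \<in> int ` cells_meeting h {x..y}"
    then obtain i where p: "p = int i" and "cell h i \<inter> {x..y} \<noteq> {}"
      by (auto simp: cells_meeting_def)
    then obtain z where z: "z \<in> cell h i" "x \<le> z" "z \<le> y" by auto
    have "x \<le> (real i + 1) * h" "real i * h \<le> y" using z by (auto simp: cell_def)
    then have "x / h - 1 \<le> real i" "real i \<le> y / h" using \<open>h > 0\<close> by (simp_all add: field_simps)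
    then show "p \<in> ?P" unfolding p atLeastAtMost_iff ceiling_le_iff le_floor_iff by simp
  qed
  then have "finite (int ` cells_meeting h {x..y})" by (rule finite_subset) simp
  then show "finite (cells_meeting h {x..y})" by (simp add: finite_image_iff)
  have "card (cells_meeting h {x..y}) = card (int ` cells_meeting h {x..y})" by (simp add: card_image)
  also have "\<dots> \<le> card ?P" using image_subset by (intro card_mono) auto
  finally have "real (card (cells_meeting h {x..y})) \<le> real (card ?P)" by simp
  also have "\<dots> \<le> y / h - (x / h - 1) + 1"
    using divide_right_mono[of x y h] assms by (intro card_int_interval_le) linarith
  finally show "real (card (cells_meeting h {x..y})) \<le> (y - x) / h + 2"
    by (simp add: diff_divide_distrib)
qed

lemma squares_meeting_mono: "A \<subseteq> B \<Longrightarrow> squares_meeting h A \<subseteq> squares_meeting h B"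
  by (auto simp: squares_meeting_def)

lemma squares_meeting_Times: "squares_meeting h (A \<times> B) = cells_meeting h A \<times> cells_meeting h B"
  by (auto simp: squares_meeting_def cells_meeting_def square_def Times_Int_Times)

lemma squares_meeting_UN: "squares_meeting h (\<Union>i\<in>I. B i) = (\<Union>i\<in>I. squares_meeting h (B i))"
  by (auto simp: squares_meeting_def)

lemma subset_interval_square_if_diameter_le:
  fixes U :: "(real \<times> real) set"
  assumes "bounded U" "diameter U \<le> r" "z \<in> U"
  shows "U \<subseteq> {fst z - r..fst z + r} \<times> {snd z - r..snd z + r}"
proof
  fix w assume "w \<in> U"
  then have "dist w z \<le> r" using diameter_bounded_bound[of U w z] assms by simp
  then have "dist (fst w) (fst z) \<le> r" "dist (snd w) (snd z) \<le> r"
    using dist_fst_le[of w z] dist_snd_le[of w z] by linarith+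
  then show "w \<in> {fst z - r..fst z + r} \<times> {snd z - r..snd z + r}"
    by (auto simp: dist_real_def mem_Times_iff)
qed

lemma
  assumes "bounded U" "diameter U \<le> r" "0 < h" "h \<le> r"
  shows finite_squares_meeting_bounded: "finite (squares_meeting h U)"
    and card_squares_meeting_bounded_le: "real (card (squares_meeting h U)) \<le> 16 * (r / h)\<^sup>2"
proof -
  define I where "I x = cells_meeting h {x - r..x + r}" for x
  have cells_near: "finite (I x)" "real (card (I x)) \<le> 4 * (r / h)" for x
  proof -
    show "finite (I x)" unfolding I_def using assms by (intro finite_cells_meeting_interval) auto
    have "real (card (I x)) \<le> (x + r - (x - r)) / h + 2"
      unfolding I_def using assms by (intro card_cells_meeting_interval_le) auto
    also have "\<dots> \<le> 4 * (r / h)" using assms by (simp add: field_simps)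
    finally show "real (card (I x)) \<le> 4 * (r / h)" .
  qed
  have "finite (squares_meeting h U) \<and> real (card (squares_meeting h U)) \<le> 16 * (r / h)\<^sup>2"
  proof (cases "U = {}")
    case False
    then obtain z where "z \<in> U" by blast
    have squares_subset: "squares_meeting h U \<subseteq> I (fst z) \<times> I (snd z)"
      using squares_meeting_mono[OF subset_interval_square_if_diameter_le[OF assms(1,2) \<open>z \<in> U\<close>]]
      unfolding squares_meeting_Times I_def .
    have finite_product: "finite (I (fst z) \<times> I (snd z))" using cells_near by simp
    have "real (card (squares_meeting h U)) \<le> real (card (I (fst z))) * real (card (I (snd z)))"
      using card_mono[OF finite_product squares_subset] by (simp add: card_cartesian_product flip: of_nat_mult)
    also have "\<dots> \<le> (4 * (r / h)) * (4 * (r / h))"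
      using assms by (intro mult_mono cells_near) auto
    finally show ?thesis using finite_subset[OF squares_subset finite_product] by (simp add: power2_eq_square)
  qed (simp add: squares_meeting_def)
  then show "finite (squares_meeting h U)" "real (card (squares_meeting h U)) \<le> 16 * (r / h)\<^sup>2"
    by auto
qed

lemma div_vimage_singleton:
  fixes M u :: nat
  assumes "M > 0"
  shows "{i. i div M = u} = {u * M..<u * M + M}"
proof -
  have "i div M = u \<longleftrightarrow> u * M \<le> i \<and> i < u * M + M" for i
  proof -
    have "i div M = u \<longleftrightarrow> u \<le> i div M \<and> i div M < Suc u" by auto
    also have "\<dots> \<longleftrightarrow> u * M \<le> i \<and> i < Suc u * M"
      by (simp only: less_eq_div_iff_mult_less_eq[OF assms] div_less_iff_less_mult[OF assms])
    finally show ?thesis by (simp add: add.commute)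
  qed
  then show ?thesis by (simp add: set_eq_iff)
qed

lemma cell_subset_div:
  assumes "h \<ge> 0" "M > 0"
  shows "cell h i \<subseteq> cell (real M * h) (i div M)"
proof -
  have "i \<in> {(i div M) * M..<(i div M) * M + M}" using div_vimage_singleton[OF assms(2)] by blast
  then have "real ((i div M) * M) \<le> real i" "real (i + 1) \<le> real ((i div M) * M + M)"
    by (simp_all only: of_nat_le_iff atLeastLessThan_iff) auto
  then have "real (i div M) * real M \<le> real i" "real i + 1 \<le> (real (i div M) + 1) * real M"
    by (simp_all add: algebra_simps)
  then have "real (i div M) * real M * h \<le> real i * h"
      "(real i + 1) * h \<le> (real (i div M) + 1) * real M * h"
    using assms(1) by (intro mult_right_mono; simp)+
  then show ?thesis by (auto simp: cell_def mult.assoc)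
qed

lemma square_subset_ancestor:
  assumes "h \<ge> 0" "M > 0"
  shows "square h c \<subseteq> square (real M * h) (ancestor M c)"
  using cell_subset_div[OF assms] by (simp add: square_def ancestor_def Sigma_mono)

lemma ancestor_ancestor: "ancestor M (ancestor M' c) = ancestor (M' * M) c"
  by (simp add: ancestor_def div_mult2_eq)

lemma
  assumes "M > 0"
  shows finite_ancestor_eq: "finite {c. ancestor M c = s}"
    and card_ancestor_eq: "card {c. ancestor M c = s} = M\<^sup>2"
proof -
  have "{c. ancestor M c = s} = {i. i div M = fst s} \<times> {j. j div M = snd s}"
    by (auto simp: ancestor_def prod_eq_iff)
  then show "finite {c. ancestor M c = s}" "card {c. ancestor M c = s} = M\<^sup>2"
    using assms by (simp_all add: div_vimage_singleton card_cartesian_product power2_eq_square)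
qed

lemma
  assumes "M > 0" "finite S"
  shows finite_ancestor_mem: "finite {c. ancestor M c \<in> S}"
    and card_ancestor_mem: "card {c. ancestor M c \<in> S} = card S * M\<^sup>2"
proof -
  have vimage_eq: "{c. ancestor M c \<in> S} = (\<Union>s\<in>S. {c. ancestor M c = s})" by auto
  show "finite {c. ancestor M c \<in> S}" unfolding vimage_eq using assms by (simp add: finite_ancestor_eq)
  show "card {c. ancestor M c \<in> S} = card S * M\<^sup>2"
    unfolding vimage_eq using assms
    by (subst card_UN_disjoint) (auto simp: finite_ancestor_eq card_ancestor_eq)
qed

lemma card_le_if_meets_sparsely:
  assumes "meets_sparsely \<epsilon> h M B" "M > 0" "finite S"
  shows "real (card {c \<in> squares_meeting h B. ancestor M c \<in> S}) \<le> \<epsilon> * (real M)\<^sup>2 * card S"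
proof -
  have "real (card {c \<in> squares_meeting h B. ancestor M c \<in> S})
      \<le> (\<Sum>s\<in>S. real (card {c \<in> squares_meeting h B. ancestor M c = s}))"
    using assms by (intro card_le_sum_if_subset_UN) (auto intro: finite_subset[OF _ finite_ancestor_eq])
  also have "\<dots> \<le> (\<Sum>s\<in>S. \<epsilon> * (real M)\<^sup>2)"
    using assms(1) unfolding meets_sparsely_def by (intro sum_mono) blast
  finally show ?thesis by (simp add: mult.commute)
qed

lemma meets_sparsely_UN:
  assumes "finite Q" "M > 0" "\<And>q. q \<in> Q \<Longrightarrow> meets_sparsely (\<epsilon> q) h M (B q)"
  shows "meets_sparsely (\<Sum>q\<in>Q. \<epsilon> q) h M (\<Union>q\<in>Q. B q)"
  unfolding meets_sparsely_def
proof
  fix s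
  have "real (card {c \<in> squares_meeting h (\<Union>q\<in>Q. B q). ancestor M c = s})
      \<le> (\<Sum>q\<in>Q. real (card {c \<in> squares_meeting h (B q). ancestor M c = s}))"
    using assms by (intro card_le_sum_if_subset_UN)
      (auto simp: squares_meeting_UN intro: finite_subset[OF _ finite_ancestor_eq])
  also have "\<dots> \<le> (\<Sum>q\<in>Q. \<epsilon> q * (real M)\<^sup>2)"
    using assms(3) unfolding meets_sparsely_def by (intro sum_mono) blast
  finally show "real (card {c \<in> squares_meeting h (\<Union>q\<in>Q. B q). ancestor M c = s})
      \<le> (\<Sum>q\<in>Q. \<epsilon> q) * (real M)\<^sup>2"
    by (simp add: sum_distrib_right)
qed

lemma meets_sparsely_mono:
  assumes "meets_sparsely \<epsilon> h M B" "A \<subseteq> B" "\<epsilon> \<le> \<epsilon>'" "M > 0"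
  shows "meets_sparsely \<epsilon>' h M A"
  unfolding meets_sparsely_def
proof
  fix s
  have "card {c \<in> squares_meeting h A. ancestor M c = s} \<le> card {c \<in> squares_meeting h B. ancestor M c = s}"
    using squares_meeting_mono[OF assms(2)] assms(4)
    by (intro card_mono) (auto intro: finite_subset[OF _ finite_ancestor_eq])
  also have "\<dots> \<le> \<epsilon> * (real M)\<^sup>2" using assms(1) unfolding meets_sparsely_def by blast
  also have "\<dots> \<le> \<epsilon>' * (real M)\<^sup>2" using assms(3) by (intro mult_right_mono) auto
  finally show "card {c \<in> squares_meeting h A. ancestor M c = s} \<le> \<epsilon>' * (real M)\<^sup>2" by simp
qed

lemma meets_sparsely_Times:
  fixes a b :: real
  assumes "\<And>u. real (card {i \<in> cells_meeting h A. i div M = u}) \<le> a * M"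
    and "\<And>u. real (card {i \<in> cells_meeting h B. i div M = u}) \<le> b * M"
  shows "meets_sparsely (a * b) h M (A \<times> B)"
  unfolding meets_sparsely_def
proof
  fix s
  have "{c \<in> squares_meeting h (A \<times> B). ancestor M c = s}
      = {i \<in> cells_meeting h A. i div M = fst s} \<times> {i \<in> cells_meeting h B. i div M = snd s}"
    by (auto simp: squares_meeting_Times ancestor_def)
  then have "real (card {c \<in> squares_meeting h (A \<times> B). ancestor M c = s})
      = real (card {i \<in> cells_meeting h A. i div M = fst s})
        * real (card {i \<in> cells_meeting h B. i div M = snd s})"
    by (simp add: card_cartesian_product)
  also have "\<dots> \<le> (a * M) * (b * M)"
    using assms by (intro mult_mono) (auto intro: order_trans[OF of_nat_0_le_iff])
  finally show "real (card {c \<in> squares_meeting h (A \<times> B). ancestor M c = s}) \<le> a * b * (real M)\<^sup>2"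
    by (simp add: power2_eq_square mult_ac)
qed

section \<open>Survivors of a removal process\<close>

locale nested_grids =
  fixes N :: "nat \<Rightarrow> nat"
  assumes pos: "0 < N n" and dvd_Suc: "N n dvd N (Suc n)"
begin

definition side :: "nat \<Rightarrow> real" where
  "side n = 1 / real (N n)"

definition ratio :: "nat \<Rightarrow> nat \<Rightarrow> nat" where
  "ratio m n = N n div N m"

lemma dvd: "m \<le> n \<Longrightarrow> N m dvd N n"
  by (induction n rule: dec_induct) (auto intro: dvd_trans[OF _ dvd_Suc])

lemma real_ratio: "m \<le> n \<Longrightarrow> real (ratio m n) = real (N n) / real (N m)"
  unfolding ratio_def by (intro real_of_nat_div dvd)

lemma ratio_pos: "m \<le> n \<Longrightarrow> 0 < ratio m n"
  unfolding ratio_def using pos dvd by (simp add: div_greater_zero_iff dvd_imp_le)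

lemma ratio_mult: "l \<le> m \<Longrightarrow> m \<le> n \<Longrightarrow> ratio m n * ratio l m = ratio l n"
  unfolding ratio_def using pos[of m] dvd by (simp add: div_mult_div_if_dvd mult.commute)

lemma side_pos: "0 < side n"
  using pos by (simp add: side_def)

lemma side_antimono: "m \<le> n \<Longrightarrow> side n \<le> side m"
  unfolding side_def using pos dvd by (intro divide_left_mono) (auto intro: dvd_imp_le)

lemma ratio_mult_side: "m \<le> n \<Longrightarrow> real (ratio m n) * side n = side m"
  using pos[of n] by (simp add: real_ratio side_def)

primrec survivors :: "(nat \<Rightarrow> (nat \<times> nat) set) \<Rightarrow> nat \<Rightarrow> (nat \<times> nat) set" where
  "survivors R 0 = {..<N 0} \<times> {..<N 0}"
| "survivors R (Suc n) = {c. ancestor (ratio n (Suc n)) c \<in> survivors R n} - R (Suc n)"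

definition surviving_fraction :: "(nat \<Rightarrow> (nat \<times> nat) set) \<Rightarrow> nat \<Rightarrow> real" where
  "surviving_fraction R n = real (card (survivors R n)) / (real (N n))\<^sup>2"

lemma finite_survivors: "finite (survivors R n)"
  by (induction n) (simp_all add: finite_ancestor_mem ratio_pos)

lemma card_survivors: "real (card (survivors R n)) = surviving_fraction R n * (real (N n))\<^sup>2"
  using pos[of n] by (simp add: surviving_fraction_def)

lemma card_subsquares_of_survivors:
  "real (card {c. ancestor (ratio n (Suc n)) c \<in> survivors R n})
    = surviving_fraction R n * (real (N (Suc n)))\<^sup>2"
  using pos[of n]
  by (simp add: card_ancestor_mem finite_survivors ratio_pos card_survivors real_ratio power_divide)

lemma surviving_fraction_0: "surviving_fraction R 0 = 1"
  using pos[of 0] by (simp add: surviving_fraction_def card_cartesian_product power2_eq_square)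

lemma surviving_fraction_Suc_eq: "R (Suc n) = {} \<Longrightarrow> surviving_fraction R (Suc n) = surviving_fraction R n"
  using card_subsquares_of_survivors[of n R] card_survivors[of R "Suc n"] pos[of "Suc n"] by simp

lemma surviving_fraction_Suc_Suc_ge:
  assumes "R (Suc (Suc n)) \<subseteq> squares_meeting (side (Suc (Suc n))) B \<union> V" "finite V"
    and sparse: "meets_sparsely \<epsilon> (side (Suc (Suc n))) (ratio n (Suc (Suc n))) B"
  shows "surviving_fraction R (Suc n) - \<epsilon> * surviving_fraction R n - card V / (real (N (Suc (Suc n))))\<^sup>2
    \<le> surviving_fraction R (Suc (Suc n))"
proof -
  let ?n = "Suc n" and ?k = "Suc (Suc n)"
  let ?A = "{c \<in> squares_meeting (side ?k) B. ancestor (ratio n ?k) c \<in> survivors R n}"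
  let ?L = "{c. ancestor (ratio ?n ?k) c \<in> survivors R ?n}"
  have "ancestor (ratio n ?k) c \<in> survivors R n" if "c \<in> ?L" for c
    using that by (simp add: ancestor_ancestor ratio_mult)
  then have "?L \<subseteq> survivors R ?k \<union> (?A \<union> V)" using assms(1) by auto
  moreover have "finite ?A"
    by (rule finite_subset[OF _ finite_ancestor_mem[OF ratio_pos finite_survivors]]) auto
  ultimately have "card ?L \<le> card (survivors R ?k \<union> (?A \<union> V))"
    using finite_survivors assms(2) by (intro card_mono) (simp_all del: survivors.simps)
  also have "\<dots> \<le> card (survivors R ?k) + (card ?A + card V)"
    using card_Un_le by (meson add_left_mono order_trans)
  finally have "real (card ?L) \<le> real (card (survivors R ?k)) + (real (card ?A) + real (card V))"
    by (simp only: flip: of_nat_add of_nat_le_iff)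
  also have "real (card ?A) \<le> \<epsilon> * surviving_fraction R n * (real (N ?k))\<^sup>2"
    using card_le_if_meets_sparsely[OF sparse ratio_pos finite_survivors, of R n] pos[of n]
    by (simp add: card_survivors real_ratio power_divide mult_ac)
  finally have "surviving_fraction R ?n * (real (N ?k))\<^sup>2
      \<le> surviving_fraction R ?k * (real (N ?k))\<^sup>2
        + (\<epsilon> * surviving_fraction R n * (real (N ?k))\<^sup>2 + real (card V))"
    unfolding card_subsquares_of_survivors card_survivors by simp
  then show ?thesis using pos[of ?k] by (simp add: field_simps)
qed

lemma ex_limit_point_of_survivors:
  assumes nonempty: "\<And>n. survivors R n \<noteq> {}"
  shows "\<exists>z. \<forall>n. \<exists>c\<in>survivors R n. z \<in> square (side n) c"
proof -
  define F where "F n = (\<Union>c\<in>survivors R n. square (side n) c)" for n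
  have "F (Suc n) \<subseteq> F n" for n
  proof
    fix z assume "z \<in> F (Suc n)"
    then obtain c where c: "c \<in> survivors R (Suc n)" "z \<in> square (side (Suc n)) c"
      by (auto simp: F_def)
    then have "z \<in> square (side n) (ancestor (ratio n (Suc n)) c)"
      using square_subset_ancestor[of "side (Suc n)" "ratio n (Suc n)" c] ratio_mult_side[of n "Suc n"]
        ratio_pos[of n "Suc n"] less_imp_le[OF side_pos] by auto
    then show "z \<in> F n" using c(1) by (auto simp: F_def)
  qed
  then have "m \<le> n \<Longrightarrow> F n \<subseteq> F m" for m n by (rule lift_Suc_antimono_le)
  moreover have "compact (square (side n) c)" for n c
    by (simp add: square_def cell_def compact_Times)
  then have "compact (F n)" for n
    unfolding F_def by (intro compact_UN finite_survivors)
  moreover have "(real (fst c) * side n, real (snd c) * side n) \<in> square (side n) c" for c n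
    using side_pos[of n] by (auto simp: square_def cell_def)
  then have "F n \<noteq> {}" for n using nonempty[of n] unfolding F_def by blast
  ultimately have "\<Inter>(range F) \<noteq> {}" by (intro compact_nest) auto
  then obtain z where "\<And>n. z \<in> F n" by blast
  then show ?thesis unfolding F_def by blast
qed

end

lemma half_power_le_if_recurrence:
  fixes d :: "nat \<Rightarrow> real"
  assumes "1 \<le> d 0" "d 0 / 2 \<le> d (Suc 0)"
    and "\<And>n. d (Suc n) - d n / 8 - 1 / (8 * 2 ^ n) \<le> d (Suc (Suc n))"
  shows "1 / 2 ^ n \<le> d n"
proof -
  have "1 / 2 ^ n \<le> d n \<and> d n / 2 \<le> d (Suc n)"
  proof (induction n)
    case 0
    then show ?case using assms(1,2) by simp
  next
    case (Suc n)
    define e :: real where "e = 1 / 2 ^ n"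
    have "1 / (8 * 2 ^ n) = e / 8" "1 / 2 ^ Suc n = e / 2" by (simp_all add: e_def)
    moreover have "e \<le> d n" "d n / 2 \<le> d (Suc n)" using Suc.IH by (simp_all add: e_def)
    ultimately show ?case using assms(3)[of n] by (intro conjI) linarith+
  qed
  then show ?thesis ..
qed

section \<open>Avoiding a cover\<close>

lemma finite_summable_ge:
  fixes f :: "nat \<Rightarrow> real"
  assumes "summable f" "0 < e"
  shows "finite {i. e \<le> f i}"
proof -
  have "\<forall>\<^sub>F i in sequentially. f i < e"
    using summable_LIMSEQ_zero[OF assms(1)] assms(2) by (rule order_tendstoD(2))
  then have "\<forall>\<^sub>F i in cofinite. \<not> e \<le> f i" by (simp add: cofinite_eq_sequentially not_le)
  then show ?thesis by (simp add: eventually_cofinite)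
qed

lemma power2_le_powr_if_power_le:
  fixes a x :: real
  assumes "0 < a" "(2 powr (1 / a)) ^ n \<le> x"
  shows "2 ^ n \<le> x powr a"
proof -
  have "2 ^ n = ((2 powr (1 / a)) ^ n) powr a"
    using \<open>0 < a\<close> by (simp add: powr_powr flip: powr_realpow)
  also have "\<dots> \<le> x powr a" using assms by (intro powr_mono2) auto
  finally show ?thesis .
qed

context nested_grids
begin

definition at_scale :: "(nat \<Rightarrow> real) \<Rightarrow> nat \<Rightarrow> nat set" where
  "at_scale r n = {i. side (Suc n) \<le> r i \<and> r i < side n}"

definition squares_meeting_at_scale ::
    "(nat \<Rightarrow> (real \<times> real) set) \<Rightarrow> (nat \<Rightarrow> real) \<Rightarrow> nat \<Rightarrow> (nat \<times> nat) set" where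
  "squares_meeting_at_scale U r n = (\<Union>i\<in>at_scale r n. squares_meeting (side (Suc n)) (U i))"

lemma finite_at_scale:
  assumes "summable (\<lambda>i. r i powr t)" "0 \<le> t"
  shows "finite (at_scale r n)"
proof (rule finite_subset)
  show "finite {i. side (Suc n) powr t \<le> r i powr t}"
    using assms(1) side_pos[of "Suc n"] by (intro finite_summable_ge) auto
  show "at_scale r n \<subseteq> {i. side (Suc n) powr t \<le> r i powr t}"
    using assms(2) less_imp_le[OF side_pos] by (auto simp: at_scale_def intro: powr_mono2)
qed

lemma finite_squares_meeting_at_scale:
  assumes "summable (\<lambda>i. r i powr t)" "0 \<le> t" "\<And>i. bounded (U i)" "\<And>i. diameter (U i) \<le> r i"
  shows "finite (squares_meeting_at_scale U r n)"
  unfolding squares_meeting_at_scale_def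
proof (intro finite_UN_I finite_at_scale[OF assms(1,2)])
  show "finite (squares_meeting (side (Suc n)) (U i))" if "i \<in> at_scale r n" for i
    using that finite_squares_meeting_bounded[OF assms(3,4) side_pos] by (simp add: at_scale_def)
qed

lemma card_squares_meeting_at_scale_le:
  assumes "summable (\<lambda>i. r i powr t)" "0 \<le> t" "t \<le> 2"
    and U: "\<And>i. bounded (U i)" "\<And>i. diameter (U i) \<le> r i"
  shows "real (card (squares_meeting_at_scale U r n))
    \<le> 16 * (real (N (Suc n)))\<^sup>2 * side n powr (2 - t) * (\<Sum>i. r i powr t)"
proof -
  define C where "C = 16 * (real (N (Suc n)))\<^sup>2 * side n powr (2 - t)"
  have squares_meeting_U: "finite (squares_meeting (side (Suc n)) (U i))"
      "real (card (squares_meeting (side (Suc n)) (U i))) \<le> 16 * (r i / side (Suc n))\<^sup>2"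
    if "i \<in> at_scale r n" for i
    using that finite_squares_meeting_bounded[OF U side_pos] card_squares_meeting_bounded_le[OF U side_pos]
    by (simp_all add: at_scale_def)
  have card_le: "real (card (squares_meeting (side (Suc n)) (U i))) \<le> C * r i powr t"
    if i_at_scale: "i \<in> at_scale r n" for i
  proof -
    have r: "0 < r i" "r i \<le> side n" using i_at_scale side_pos[of "Suc n"] by (auto simp: at_scale_def)
    have "(r i)\<^sup>2 = r i powr (2 - t) * r i powr t"
      using r(1) by (simp flip: powr_add)
    also have "\<dots> \<le> side n powr (2 - t) * r i powr t"
      using r \<open>t \<le> 2\<close> by (intro mult_right_mono powr_mono2) auto
    finally have "16 * (real (N (Suc n)))\<^sup>2 * (r i)\<^sup>2
        \<le> 16 * (real (N (Suc n)))\<^sup>2 * (side n powr (2 - t) * r i powr t)"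
      by (intro mult_left_mono) auto
    then show ?thesis
      using squares_meeting_U(2)[OF i_at_scale] by (simp add: side_def C_def power_mult_distrib mult_ac)
  qed
  have "real (card (squares_meeting_at_scale U r n))
      \<le> (\<Sum>i\<in>at_scale r n. real (card (squares_meeting (side (Suc n)) (U i))))"
    using squares_meeting_U(1) finite_at_scale[OF assms(1,2)]
    by (intro card_le_sum_if_subset_UN) (auto simp: squares_meeting_at_scale_def)
  also have "\<dots> \<le> C * (\<Sum>i\<in>at_scale r n. r i powr t)"
    unfolding sum_distrib_left by (intro sum_mono card_le)
  also have "\<dots> \<le> C * (\<Sum>i. r i powr t)"
    using assms(1) finite_at_scale[OF assms(1,2)] side_pos[of n]
    by (intro mult_left_mono sum_le_suminf) (auto simp: C_def)
  finally show ?thesis unfolding C_def .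
qed

lemma ex_at_scale_Suc:
  assumes "side n \<le> r i" "r i < side (Suc 0)"
  shows "\<exists>m. i \<in> at_scale r (Suc m)"
proof -
  have "side (Suc n) \<le> r i" using assms(1) side_antimono[of n "Suc n"] by simp
  then obtain m where "\<not> side (Suc m) \<le> r i" "side (Suc (Suc m)) \<le> r i"
    using ex_least_nat_less[of "\<lambda>m. side (Suc m) \<le> r i" n] assms(2) by auto
  then show ?thesis by (auto simp: at_scale_def)
qed

lemma ex_side_le:
  assumes growth: "\<And>n. 2 ^ n \<le> real (N n) powr a" and "0 < a" "0 < x"
  shows "\<exists>n. side n \<le> x"
proof -
  obtain n where "(1 / x) powr a < 2 ^ n" using real_arch_pow[of 2 "(1 / x) powr a"] by auto
  also have "\<dots> \<le> real (N n) powr a" by (rule growth)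
  finally have "1 / x < real (N n)"
    by (rule powr_less_cancel2[rotated 3]) (use \<open>0 < a\<close> \<open>0 < x\<close> pos[of n] in simp_all)
  then have "side n \<le> x" using \<open>0 < x\<close> pos[of n]
    by (simp add: side_def divide_le_eq divide_less_eq mult.commute)
  then show ?thesis ..
qed

lemma side_powr_le:
  assumes "2 ^ n \<le> real (N n) powr a"
  shows "side n powr a \<le> 1 / 2 ^ n"
  using assms pos[of n] by (simp add: side_def powr_divide field_simps)

text \<open>The sets removed at a stage are equidistributed only relative to the squares of two stages
  before. Since at least half of the area survives each single stage, losing an eighth of the
  older area costs at most a quarter of the present one.\<close>

lemma survivors_nonempty_if_removing_little:
  assumes R_Suc_0: "R (Suc 0) = {}"
    and removed: "\<And>n. R (Suc (Suc n)) \<subseteq> squares_meeting (side (Suc (Suc n))) (B (Suc (Suc n))) \<union> V n"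
    and sparse: "\<And>n. meets_sparsely (1 / 8) (side (Suc (Suc n))) (ratio n (Suc (Suc n))) (B (Suc (Suc n)))"
    and few: "\<And>n. finite (V n)" "\<And>n. real (card (V n)) \<le> (real (N (Suc (Suc n))))\<^sup>2 / (8 * 2 ^ n)"
  shows "survivors R n \<noteq> {}"
proof -
  have "surviving_fraction R (Suc n) - surviving_fraction R n / 8 - 1 / (8 * 2 ^ n)
      \<le> surviving_fraction R (Suc (Suc n))" for n
  proof -
    have "surviving_fraction R (Suc n) - 1 / 8 * surviving_fraction R n
          - card (V n) / (real (N (Suc (Suc n))))\<^sup>2
        \<le> surviving_fraction R (Suc (Suc n))"
      using removed few(1) sparse by (rule surviving_fraction_Suc_Suc_ge)
    moreover have "card (V n) / (real (N (Suc (Suc n))))\<^sup>2 \<le> 1 / (8 * 2 ^ n)"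
      using few(2)[of n] pos[of "Suc (Suc n)"] by (simp add: field_simps)
    ultimately show ?thesis by simp
  qed
  then have "1 / 2 ^ n \<le> surviving_fraction R n"
    using R_Suc_0 by (intro half_power_le_if_recurrence)
      (simp_all add: surviving_fraction_0 surviving_fraction_Suc_eq)
  moreover have "(0::real) < 1 / 2 ^ n" by simp
  ultimately have "surviving_fraction R n \<noteq> 0" by linarith
  then show ?thesis by (auto simp: surviving_fraction_def)
qed

lemma card_squares_meeting_at_scale_Suc_le:
  assumes t: "0 \<le> t" "t \<le> 2" and growth: "2 ^ Suc n \<le> real (N (Suc n)) powr (2 - t)"
    and U: "\<And>i. bounded (U i)" "\<And>i. diameter (U i) \<le> r i"
    and summable: "summable (\<lambda>i. r i powr t)" and sum_le: "(\<Sum>i. r i powr t) \<le> 1 / 64"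
  shows "real (card (squares_meeting_at_scale U r (Suc n))) \<le> (real (N (Suc (Suc n))))\<^sup>2 / (8 * 2 ^ n)"
proof -
  have "real (card (squares_meeting_at_scale U r (Suc n)))
      \<le> 16 * (real (N (Suc (Suc n))))\<^sup>2 * side (Suc n) powr (2 - t) * (\<Sum>i. r i powr t)"
    using summable t U by (intro card_squares_meeting_at_scale_le)
  also have "\<dots> \<le> 16 * (real (N (Suc (Suc n))))\<^sup>2 * (1 / 2 ^ Suc n) * (1 / 64)"
    using side_powr_le[OF growth] sum_le summable
    by (intro mult_mono mult_nonneg_nonneg suminf_nonneg) auto
  also have "\<dots> = (real (N (Suc (Suc n))))\<^sup>2 / (8 * 2 ^ n)" by simp
  finally show ?thesis .
qed

lemma ex_point_avoiding_sparse_and_small_sets: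
  assumes t: "0 \<le> t" "t < 2"
    and growth: "\<And>n. 2 ^ n \<le> real (N n) powr (2 - t)"
    and sparse: "\<And>n. meets_sparsely (1 / 8) (side (Suc (Suc n))) (ratio n (Suc (Suc n))) (B (Suc (Suc n)))"
    and U: "\<And>i. bounded (U i)" "\<And>i. diameter (U i) \<le> r i"
    and r: "\<And>i. 0 < r i" "\<And>i. r i < side (Suc 0)"
    and summable: "summable (\<lambda>i. r i powr t)" and sum_le: "(\<Sum>i. r i powr t) \<le> 1 / 64"
  shows "\<exists>z. (\<forall>i. z \<notin> U i) \<and> (\<forall>n. z \<notin> B (Suc (Suc n)))"
proof -
  define V where "V n = squares_meeting_at_scale U r (Suc n)" for n
  define R where "R n = (if n < 2 then {} else squares_meeting (side n) (B n) \<union> V (n - 2))" for n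
  have R_Suc_Suc: "R (Suc (Suc n)) = squares_meeting (side (Suc (Suc n))) (B (Suc (Suc n))) \<union> V n" for n
    by (simp add: R_def)
  have card_V: "real (card (V n)) \<le> (real (N (Suc (Suc n))))\<^sup>2 / (8 * 2 ^ n)" for n
    unfolding V_def
    by (rule card_squares_meeting_at_scale_Suc_le[OF t(1) less_imp_le[OF t(2)] growth U summable sum_le])
  have "survivors R n \<noteq> {}" for n
  proof (rule survivors_nonempty_if_removing_little[OF _ _ sparse _ card_V])
    show "R (Suc 0) = {}" by (simp add: R_def)
    show "finite (V n)" for n
      unfolding V_def by (rule finite_squares_meeting_at_scale[OF summable t(1) U])
  qed (simp add: R_Suc_Suc)
  then obtain z where z: "\<And>n. \<exists>c\<in>survivors R n. z \<in> square (side n) c"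
    using ex_limit_point_of_survivors by blast
  have not_removed: "\<exists>c. z \<in> square (side (Suc (Suc n))) c \<and> c \<notin> R (Suc (Suc n))" for n
    using z[of "Suc (Suc n)"] by auto
  have "z \<notin> B (Suc (Suc n))" for n
    using not_removed[of n] by (auto simp: R_Suc_Suc squares_meeting_def)
  moreover have "z \<notin> U i" for i
  proof
    assume "z \<in> U i"
    obtain n where "side n \<le> r i" using ex_side_le[OF growth _ r(1)] t by auto
    then obtain m where "i \<in> at_scale r (Suc m)" using ex_at_scale_Suc[of n r i] r(2) by blast
    then show False
      using not_removed[of m] \<open>z \<in> U i\<close>
      by (auto simp: R_Suc_Suc V_def squares_meeting_at_scale_def squares_meeting_def)
  qed
  ultimately show ?thesis by blast
qed

lemma nested_grids_shift: "nested_grids (\<lambda>n. N (k + n))"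
  using pos dvd_Suc by unfold_locales simp_all

theorem hausdorff_measure_eventually_notin_neq_0:
  assumes growth: "\<And>C::real. \<forall>\<^sub>F n in sequentially. C ^ n \<le> real (N n)"
    and sparse: "\<forall>\<^sub>F n in sequentially.
      meets_sparsely (1 / 8) (side (Suc (Suc n))) (ratio n (Suc (Suc n))) (B (Suc (Suc n)))"
    and "s < 2"
  shows "hausdorff_measure s {z. \<forall>\<^sub>F n in sequentially. z \<notin> B n} \<noteq> 0"
proof
  let ?E = "{z. \<forall>\<^sub>F n in sequentially. z \<notin> B n}"
  define t where "t = max s 1"
  have t: "s \<le> t" "0 < t" "t < 2" using \<open>s < 2\<close> by (auto simp: t_def)
  assume "hausdorff_measure s ?E = 0"
  then have null: "hausdorff_measure t ?E = 0" using t(1) by (rule hausdorff_measure_eq_0_exponent_mono)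
  obtain k where k: "\<And>n. n \<ge> k \<Longrightarrow> (2 powr (1 / (2 - t))) ^ n \<le> real (N n)"
      "\<And>n. n \<ge> k \<Longrightarrow> meets_sparsely (1 / 8) (side (Suc (Suc n))) (ratio n (Suc (Suc n))) (B (Suc (Suc n)))"
    using eventually_conj[OF growth sparse] unfolding eventually_sequentially by blast
  interpret shifted: nested_grids "\<lambda>n. N (k + n)" by (rule nested_grids_shift)
  have shifted: "shifted.side = (\<lambda>n. side (k + n))" "shifted.ratio = (\<lambda>m n. ratio (k + m) (k + n))"
    by (auto simp: fun_eq_iff shifted.side_def side_def shifted.ratio_def ratio_def)
  have growth_shifted: "2 ^ n \<le> real (N (k + n)) powr (2 - t)" for n
  proof -
    have "(2::real) ^ n \<le> 2 ^ (k + n)" by (intro power_increasing) auto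
    also have "\<dots> \<le> real (N (k + n)) powr (2 - t)"
      using k(1)[of "k + n"] t by (intro power2_le_powr_if_power_le) auto
    finally show ?thesis .
  qed
  obtain U r where cover: "?E \<subseteq> (\<Union>i. U i)" and U: "\<And>i. bounded (U i)" "\<And>i. diameter (U i) \<le> r i"
    and r: "\<And>i. 0 < r i" "\<And>i. r i < shifted.side (Suc 0)"
    and sum: "summable (\<lambda>i. r i powr t)" "(\<Sum>i. r i powr t) \<le> 1 / 64"
    by (rule hausdorff_measure_eq_0_coverE[OF null t(2) shifted.side_pos[of "Suc 0"], of "1 / 64"])
      (simp, blast)
  obtain z where z: "\<And>i. z \<notin> U i" "\<And>n. z \<notin> B (k + Suc (Suc n))"
    using shifted.ex_point_avoiding_sparse_and_small_sets
        [of t "\<lambda>n. B (k + n)", OF _ t(3) growth_shifted _ U r sum]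
      t(2) k(2)[of "k + _"] by (auto simp: shifted)
  have "z \<notin> B n" if "k + 2 \<le> n" for n
    using le_Suc_ex[OF that] z(2) by auto
  then have "z \<in> ?E" by (auto simp: eventually_sequentially)
  then show False using cover z(1) by blast
qed

end

section \<open>Neighbourhoods of hyperbolas\<close>

lemma nint_dist_le_iff: "nint_dist x \<le> a \<longleftrightarrow> (\<exists>p::int. \<bar>x - of_int p\<bar> \<le> a)"
proof
  assume "nint_dist x \<le> a"
  moreover obtain z where "z \<in> \<int>" "infdist x \<int> = dist x z"
    using infdist_attains_inf[OF closed_Ints, of x] Ints_0 by blast
  ultimately show "\<exists>p::int. \<bar>x - of_int p\<bar> \<le> a"
    by (auto simp: nint_dist_def dist_real_def elim!: Ints_cases)
next
  assume "\<exists>p::int. \<bar>x - of_int p\<bar> \<le> a"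
  then obtain p :: int where "dist x (of_int p) \<le> a" by (auto simp: dist_real_def)
  then show "nint_dist x \<le> a"
    unfolding nint_dist_def using infdist_le[OF Ints_of_int] order_trans by blast
qed

lemma nint_dist_nonneg: "0 \<le> nint_dist x"
  by (simp add: nint_dist_def infdist_nonneg)

lemma nint_dist_le_1: "nint_dist x \<le> 1"
  unfolding nint_dist_le_iff by (rule exI[of _ "\<lfloor>x\<rfloor>"]) linarith

lemma card_cells_near_rationals_le_mult:
  fixes q M u :: nat and h a :: real
  assumes "h > 0" "M > 0" "q > 0" "a \<ge> 0"
  shows "real (card {i \<in> cells_meeting h {x. nint_dist (q * x) \<le> a}. i div M = u})
    \<le> (q * h * M + 2 * a + 1) * (2 * a / (q * h) + 2)" (is "real (card ?N) \<le> _")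
proof -
  define x where "x = real q * (real u * (M * h)) - a"
  define y where "y = real q * ((real u + 1) * (M * h)) + a"
  define I where "I p = cells_meeting h {(of_int p - a) / q .. (of_int p + a) / q}" for p :: int
  have length_eq: "y - x = q * h * M + 2 * a" by (simp add: x_def y_def algebra_simps)
  moreover have "0 \<le> q * h * M" "0 \<le> 2 * a / (q * h) + 2" using assms by simp_all
  ultimately have x_le_y: "x \<le> y" and factor_nonneg: "0 \<le> 2 * a / (q * h) + 2" using \<open>a \<ge> 0\<close> by linarith+
  have cells_near: "finite (I p)" "real (card (I p)) \<le> 2 * a / (q * h) + 2" for p
    using finite_cells_meeting_interval[OF \<open>h > 0\<close>, of "(of_int p - a) / q" "(of_int p + a) / q"]
      card_cells_meeting_interval_le[OF \<open>h > 0\<close>, of "(of_int p - a) / q" "(of_int p + a) / q"] assms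
    by (simp_all add: I_def divide_right_mono flip: diff_divide_distrib)
  have "?N \<subseteq> (\<Union>p\<in>{\<lceil>x\<rceil>..\<lfloor>y\<rfloor>}. I p)"
  proof
    fix i assume "i \<in> ?N"
    then obtain z :: real and p :: int where z: "z \<in> cell h i" "i div M = u" and p: "\<bar>q * z - of_int p\<bar> \<le> a"
      by (auto simp: cells_meeting_def nint_dist_le_iff)
    then have "z \<in> cell (M * h) u" using cell_subset_div[of h M i] assms by auto
    then have "q * (real u * (M * h)) \<le> q * z" "q * z \<le> q * ((real u + 1) * (M * h))"
      by (auto simp: cell_def intro!: mult_left_mono)
    then have "p \<in> {\<lceil>x\<rceil>..\<lfloor>y\<rfloor>}"
      using p unfolding atLeastAtMost_iff ceiling_le_iff le_floor_iff x_def y_def by linarith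
    moreover have "i \<in> I p"
      using z(1) p \<open>q > 0\<close> by (auto simp: I_def cells_meeting_def field_simps abs_le_iff)
    ultimately show "i \<in> (\<Union>p\<in>{\<lceil>x\<rceil>..\<lfloor>y\<rfloor>}. I p)" by blast
  qed
  then have "real (card ?N) \<le> (\<Sum>p\<in>{\<lceil>x\<rceil>..\<lfloor>y\<rfloor>}. real (card (I p)))"
    using cells_near(1) by (intro card_le_sum_if_subset_UN) auto
  also have "\<dots> \<le> real (card {\<lceil>x\<rceil>..\<lfloor>y\<rfloor>}) * (2 * a / (q * h) + 2)"
    by (intro sum_bounded_above cells_near(2))
  also have "\<dots> \<le> (y - x + 1) * (2 * a / (q * h) + 2)"
    using x_le_y factor_nonneg by (intro mult_right_mono card_int_interval_le)
  finally show ?thesis by (simp add: length_eq)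
qed

lemma card_cells_near_rationals_le:
  fixes q M u :: nat and h a :: real
  assumes "h > 0" "M > 0" "q > 0" "q * h \<le> a" "1 \<le> q * h * M"
  shows "real (card {i \<in> cells_meeting h {x. nint_dist (q * x) \<le> a}. i div M = u}) \<le> 12 * a * M"
    (is "real (card ?N) \<le> _")
proof (cases "a \<le> 1 / 2")
  case True
  have qh_pos: "0 < q * h" using assms by simp
  then have "0 < a" using assms by linarith
  have "real (card ?N) \<le> (q * h * M + 2 * a + 1) * (2 * a / (q * h) + 2)"
    using assms qh_pos by (intro card_cells_near_rationals_le_mult) linarith+
  also have "\<dots> \<le> (3 * (q * h * M)) * (4 * a / (q * h))"
    using assms True qh_pos \<open>0 < a\<close> by (intro mult_mono) (auto simp: field_simps)
  also have "\<dots> = 12 * a * M" using \<open>h > 0\<close> \<open>q > 0\<close> by simp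
  finally show ?thesis .
next
  case False
  have "card ?N \<le> card {i. i div M = u}"
    using \<open>M > 0\<close> by (intro card_mono) (simp add: div_vimage_singleton, blast)
  also have "\<dots> = M" using \<open>M > 0\<close> by (simp add: div_vimage_singleton)
  finally have "real (card ?N) \<le> 1 * real M" by simp
  also have "\<dots> \<le> 12 * a * M" using False by (intro mult_right_mono) auto
  finally show ?thesis .
qed

definition hyperbolic_set :: "nat \<Rightarrow> real \<Rightarrow> (real \<times> real) set" where
  "hyperbolic_set q \<epsilon> = {(x, y). nint_dist (q * x) * nint_dist (q * y) < \<epsilon>}"

lemma ex_dyadic_box:
  fixes u v :: real
  assumes "u \<le> 1" "0 \<le> v" "v \<le> 1" "u * v < \<epsilon>" "1 / 2 ^ J \<le> \<epsilon>"
  shows "\<exists>j\<le>J. u \<le> 1 / 2 ^ j \<and> v \<le> \<epsilon> * 2 ^ (j + 1)"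
proof -
  obtain j where j: "j \<le> J" "u \<le> 1 / 2 ^ j" "Suc j = Suc J \<or> 1 / 2 ^ Suc j < u"
    using ex_least_nat_less[of "\<lambda>j. j = Suc J \<or> 1 / 2 ^ j < u" "Suc J"] \<open>u \<le> 1\<close> by fastforce
  have "v \<le> \<epsilon> * 2 ^ (j + 1)"
  proof (cases "j = J")
    case True
    then have "1 \<le> \<epsilon> * 2 ^ j" using assms(5) by (simp add: field_simps)
    then show ?thesis using \<open>v \<le> 1\<close> by simp
  next
    case False
    then have "1 / 2 ^ Suc j * v \<le> u * v" using j(3) \<open>0 \<le> v\<close> by (intro mult_right_mono) auto
    then have "1 / 2 ^ Suc j * v \<le> \<epsilon>" using assms(4) by linarith
    then show ?thesis by (simp add: field_simps)
  qed
  then show ?thesis using j by blast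
qed

text \<open>The factor \<open>J + 1\<close> is one of the two logarithms.\<close>

lemma meets_sparsely_hyperbolic_set:
  fixes q :: nat and h \<epsilon> :: real
  assumes "h > 0" "M > 0" "q > 0" and fine: "1 \<le> q * h * M" and "q * h \<le> 1 / 2 ^ J" "1 / 2 ^ J \<le> \<epsilon>"
  shows "meets_sparsely (288 * (real J + 1) * \<epsilon>) h M (hyperbolic_set q \<epsilon>)"
proof (rule meets_sparsely_mono)
  define A where "A a = {x::real. nint_dist (q * x) \<le> a}" for a :: real
  have "0 < 1 / (2::real) ^ J" by simp
  then have "\<epsilon> > 0" using assms(6) by linarith
  have "meets_sparsely (288 * \<epsilon>) h M (A (1 / 2 ^ j) \<times> A (\<epsilon> * 2 ^ (j + 1)))" if "j \<le> J" for j
  proof -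
    have "(1::real) / 2 ^ J \<le> 1 / 2 ^ j" using that by (simp add: field_simps power_increasing)
    moreover have "\<epsilon> * 1 \<le> \<epsilon> * 2 ^ (j + 1)"
      using \<open>\<epsilon> > 0\<close> by (intro mult_left_mono one_le_power) auto
    ultimately have "q * h \<le> 1 / 2 ^ j" "q * h \<le> \<epsilon> * 2 ^ (j + 1)" using assms by linarith+
    then have "meets_sparsely (12 * (1 / 2 ^ j) * (12 * (\<epsilon> * 2 ^ (j + 1)))) h M
        (A (1 / 2 ^ j) \<times> A (\<epsilon> * 2 ^ (j + 1)))"
      unfolding A_def using assms fine by (intro meets_sparsely_Times card_cells_near_rationals_le)
    then show ?thesis by simp
  qed
  then show "meets_sparsely (\<Sum>j\<in>{..J}. 288 * \<epsilon>) h M (\<Union>j\<in>{..J}. A (1 / 2 ^ j) \<times> A (\<epsilon> * 2 ^ (j + 1)))"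
    using assms(2) by (intro meets_sparsely_UN) auto
  show "hyperbolic_set q \<epsilon> \<subseteq> (\<Union>j\<in>{..J}. A (1 / 2 ^ j) \<times> A (\<epsilon> * 2 ^ (j + 1)))"
  proof
    fix z assume "z \<in> hyperbolic_set q \<epsilon>"
    then have "\<exists>j\<le>J. nint_dist (q * fst z) \<le> 1 / 2 ^ j \<and> nint_dist (q * snd z) \<le> \<epsilon> * 2 ^ (j + 1)"
      using assms(6) by (intro ex_dyadic_box)
        (auto simp: hyperbolic_set_def nint_dist_nonneg nint_dist_le_1)
    then show "z \<in> (\<Union>j\<in>{..J}. A (1 / 2 ^ j) \<times> A (\<epsilon> * 2 ^ (j + 1)))"
      by (auto simp: A_def mem_Times_iff)
  qed
qed (use assms in \<open>auto simp: algebra_simps\<close>)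

section \<open>The stages of the construction\<close>

text \<open>Stage \<open>n\<close> treats the \<open>q\<close> with \<open>log2 q\<close> in \<open>[4^n, 4^(n+1))\<close>, for which \<open>(log2 q)\<^sup>2 \<ge> 16^n\<close>. Here
  \<open>1 / 2^depth n\<close> is a lower bound of the thresholds, and the thinnest boxes to be removed have width
  about \<open>threshold n q / q\<close>, which dictates \<open>level n\<close>. The ratio 4 of consecutive exponents makes the
  squares of stage \<open>n - 2\<close> wider than \<open>1 / q\<close>.\<close>

definition threshold :: "nat \<Rightarrow> nat \<Rightarrow> real" where
  "threshold n q = 1 / (2 ^ 16 * real q * 16 ^ n)"

definition bad :: "nat \<Rightarrow> (real \<times> real) set" where
  "bad n = (\<Union>q\<in>{2 ^ 4 ^ n..<2 ^ 4 ^ Suc n}. hyperbolic_set q (threshold n q))"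

definition depth :: "nat \<Rightarrow> nat" where
  "depth n = 4 ^ Suc n + 4 * n + 16"

definition level :: "nat \<Rightarrow> nat" where
  "level n = 4 ^ Suc n + depth n"

lemma level_mono: "m \<le> n \<Longrightarrow> level m \<le> level n"
  unfolding level_def depth_def by (intro add_mono mult_le_mono power_increasing) auto

interpretation dyadic: nested_grids "\<lambda>n. 2 ^ level n"
  by unfold_locales (auto intro!: le_imp_power_dvd level_mono)

lemma dyadic_side_eq: "dyadic.side n = 1 / 2 ^ level n"
  by (simp add: dyadic.side_def)

lemma level_le: "1 \<le> n \<Longrightarrow> level n \<le> 4 ^ Suc (Suc n)"
  by (induction n rule: nat_induct_at_least) (auto simp: level_def depth_def)

lemma Suc_depth_le: "2 \<le> n \<Longrightarrow> depth n + 1 \<le> 8 * 4 ^ n"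
  by (induction n rule: nat_induct_at_least) (auto simp: depth_def)

lemma mult_side_le_if_in_stage:
  assumes "q < 2 ^ 4 ^ Suc n"
  shows "real q * dyadic.side n \<le> 1 / 2 ^ depth n"
proof -
  have "real q \<le> real (2 ^ 4 ^ Suc n)" using assms by (intro of_nat_mono) simp
  then have "real q * dyadic.side n \<le> 2 ^ 4 ^ Suc n * dyadic.side n"
    using dyadic.side_pos[of n] by (intro mult_right_mono) auto
  also have "\<dots> = 1 / 2 ^ depth n" by (subst dyadic_side_eq) (simp add: level_def power_add)
  finally show ?thesis .
qed

lemma threshold_ge_if_in_stage:
  assumes "0 < q" "q < 2 ^ 4 ^ Suc n"
  shows "1 / 2 ^ depth n \<le> threshold n q"
proof -
  have "real q \<le> real (2 ^ 4 ^ Suc n)" using assms(2) by (intro of_nat_mono) simp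
  then have "2 ^ 16 * real q * 16 ^ n \<le> 2 ^ 16 * 2 ^ 4 ^ Suc n * 16 ^ n"
    by (intro mult_mono) auto
  also have "\<dots> = 2 ^ 16 * 2 ^ 4 ^ Suc n * 2 ^ (4 * n)" by (simp only: power_mult) simp
  also have "\<dots> = 2 ^ depth n" unfolding depth_def power_add by simp
  finally show ?thesis unfolding threshold_def using \<open>0 < q\<close> by (intro divide_left_mono) auto
qed

lemma one_le_mult_side_if_in_stage:
  assumes "1 \<le> n" "2 ^ 4 ^ Suc (Suc n) \<le> q"
  shows "1 \<le> real q * dyadic.side n"
proof -
  have "(2::real) ^ level n \<le> 2 ^ 4 ^ Suc (Suc n)"
    using level_le[OF assms(1)] by (intro power_increasing) auto
  also have "\<dots> = real (2 ^ 4 ^ Suc (Suc n))" by simp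
  also have "\<dots> \<le> real q" using assms(2) by (rule of_nat_mono)
  finally show ?thesis by (simp add: dyadic_side_eq)
qed

lemma eventually_power_le_pow_level: "\<forall>\<^sub>F n in sequentially. C ^ n \<le> real (2 ^ level n)" for C :: real
proof -
  obtain p where p: "\<bar>C\<bar> < 2 ^ p" using real_arch_pow[of 2 "\<bar>C\<bar>"] by auto
  have "C ^ n \<le> real (2 ^ level n)" if "p \<le> n" for n
  proof -
    have "n \<le> 2 ^ n" by (rule less_imp_le[OF less_exp])
    then have "p * n \<le> 2 ^ n * 2 ^ n" using that by (intro mult_le_mono) linarith+
    also have "\<dots> = 4 ^ n" by (simp flip: power_mult_distrib)
    also have "\<dots> \<le> level n" by (simp add: level_def depth_def)
    finally have exponent_le: "p * n \<le> level n" .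
    have "C ^ n \<le> \<bar>C\<bar> ^ n" by (simp flip: power_abs)
    also have "\<dots> \<le> (2 ^ p) ^ n" using p by (intro power_mono) auto
    also have "\<dots> \<le> 2 ^ level n" using exponent_le by (simp flip: power_mult)
    finally show ?thesis by simp
  qed
  then show ?thesis by (auto simp: eventually_sequentially)
qed

lemma sum_inverse_dyadic_le:
  assumes "a \<le> b"
  shows "(\<Sum>q = 2 ^ a..<2 ^ b. 1 / real q) \<le> real (b - a)"
  using assms
proof (induction b rule: dec_induct)
  case base
  then show ?case by simp
next
  case (step b)
  have "2 ^ b \<le> real q" if "2 ^ b \<le> q" for q :: nat
    using of_nat_mono[OF that, where 'a = real] by simp
  then have "(\<Sum>q = 2 ^ b..<2 ^ Suc b. 1 / real q) \<le> (\<Sum>q = 2 ^ b..<(2::nat) ^ Suc b. 1 / 2 ^ b)"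
    by (intro sum_mono divide_left_mono) auto
  then have "(\<Sum>q = 2 ^ b..<2 ^ Suc b. 1 / real q) \<le> 1" by simp
  moreover have "(\<Sum>q = 2 ^ a..<2 ^ Suc b. 1 / real q)
      = (\<Sum>q = 2 ^ a..<2 ^ b. 1 / real q) + (\<Sum>q = 2 ^ b..<2 ^ Suc b. 1 / real q)"
    using step by (intro sum.atLeastLessThan_concat[symmetric]) (auto intro: power_increasing)
  ultimately show ?case using step by simp
qed

lemma meets_sparsely_hyperbolic_set_in_stage:
  assumes "1 \<le> n" and k: "k = Suc (Suc n)" and q: "2 ^ 4 ^ k \<le> q" "q < 2 ^ 4 ^ Suc k"
  shows "meets_sparsely (9 / (256 * 4 ^ k) * (1 / real q)) (dyadic.side k) (dyadic.ratio n k)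
    (hyperbolic_set q (threshold k q))"
proof (rule meets_sparsely_mono)
  have q_pos: "0 < q" using q(1) by (meson less_le_trans zero_less_numeral zero_less_power)
  show ratio_pos: "0 < dyadic.ratio n k" by (rule dyadic.ratio_pos) (simp add: k)
  have "1 \<le> real q * dyadic.side k * real (dyadic.ratio n k)"
    using one_le_mult_side_if_in_stage[OF \<open>1 \<le> n\<close>, of q] q(1) dyadic.ratio_mult_side[of n k]
    by (simp add: k mult_ac)
  then show "meets_sparsely (288 * (real (depth k) + 1) * threshold k q)
      (dyadic.side k) (dyadic.ratio n k) (hyperbolic_set q (threshold k q))"
    using q q_pos ratio_pos
    by (intro meets_sparsely_hyperbolic_set dyadic.side_pos
        mult_side_le_if_in_stage threshold_ge_if_in_stage)
  have "real (depth k + 1) \<le> real (8 * 4 ^ k)" using Suc_depth_le[of k] k by (intro of_nat_mono) simp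
  then have "288 * (real (depth k) + 1) * threshold k q \<le> 288 * (8 * 4 ^ k) * threshold k q"
    by (intro mult_right_mono mult_left_mono) (auto simp: threshold_def)
  also have "\<dots> = 9 / (256 * 4 ^ k) * (1 / real q)"
  proof -
    have "(16::real) ^ k = 4 ^ k * 4 ^ k" by (simp flip: power_mult_distrib)
    then show ?thesis by (simp add: threshold_def)
  qed
  finally show "288 * (real (depth k) + 1) * threshold k q \<le> 9 / (256 * 4 ^ k) * (1 / real q)" .
qed simp

lemma meets_sparsely_bad:
  assumes "1 \<le> n" and k: "k = Suc (Suc n)"
  shows "meets_sparsely (1 / 8) (dyadic.side k) (dyadic.ratio n k) (bad k)"
proof (rule meets_sparsely_mono)
  show ratio_pos: "0 < dyadic.ratio n k" by (rule dyadic.ratio_pos) (simp add: k)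
  let ?Q = "{2 ^ 4 ^ k..<2 ^ 4 ^ Suc k}"
  show "meets_sparsely (\<Sum>q\<in>?Q. 9 / (256 * 4 ^ k) * (1 / real q)) (dyadic.side k) (dyadic.ratio n k) (bad k)"
    unfolding bad_def using meets_sparsely_hyperbolic_set_in_stage[OF assms] ratio_pos
    by (intro meets_sparsely_UN) auto
  have "(\<Sum>q\<in>?Q. 1 / real q) \<le> real (4 ^ Suc k - 4 ^ k)" by (rule sum_inverse_dyadic_le) simp
  also have "4 ^ Suc k - 4 ^ k = 3 * (4::nat) ^ k" by simp
  finally have "9 / (256 * 4 ^ k) * (\<Sum>q\<in>?Q. 1 / real q) \<le> 9 / (256 * 4 ^ k) * (3 * 4 ^ k)"
    by (intro mult_left_mono) auto
  also have "\<dots> \<le> 1 / 8" by simp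
  finally show "(\<Sum>q\<in>?Q. 9 / (256 * 4 ^ k) * (1 / real q)) \<le> 1 / 8" by (simp only: sum_distrib_left)
qed simp

lemma ex_stage:
  fixes q k :: nat
  assumes "2 ^ 4 ^ k \<le> q"
  shows "\<exists>n\<ge>k. 2 ^ 4 ^ n \<le> q \<and> q < 2 ^ 4 ^ Suc n"
proof -
  have "q < 4 ^ q" by (rule power_gt_expt) simp
  also have "(4::nat) ^ q < 2 ^ 4 ^ q" by (rule power_gt_expt) simp
  also have "(2::nat) ^ 4 ^ q \<le> 2 ^ 4 ^ (k + q)" by (intro power_increasing) auto
  finally obtain m where "\<not> q < 2 ^ 4 ^ (k + m)" "q < 2 ^ 4 ^ (k + Suc m)"
    using ex_least_nat_less[of "\<lambda>m. q < 2 ^ 4 ^ (k + m)" q] assms by auto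
  then show ?thesis by (intro exI[of _ "k + m"]) auto
qed

lemma ln_squared_ge:
  assumes "2 ^ 4 ^ n \<le> q"
  shows "16 ^ n * (ln 2)\<^sup>2 \<le> (ln (real q))\<^sup>2"
proof -
  have "real (2 ^ 4 ^ n) \<le> real q" using assms by (rule of_nat_mono)
  then have "ln (2 ^ 4 ^ n) \<le> ln (real q)" by (subst ln_le_cancel_iff) (auto intro: less_le_trans[rotated])
  then have "(4 ^ n * ln 2)\<^sup>2 \<le> (ln (real q))\<^sup>2" by (intro power_mono) (simp_all add: ln_realpow)
  moreover have "((4::real) ^ n)\<^sup>2 = 16 ^ n" by (simp add: power2_eq_square flip: power_mult_distrib)
  ultimately show ?thesis by (simp add: power_mult_distrib)
qed

lemma product_ge_if_notin_hyperbolic_set: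
  assumes "2 ^ 4 ^ n \<le> q" "(x, y) \<notin> hyperbolic_set q (threshold n q)"
  shows "(ln 2)\<^sup>2 / 2 ^ 16 \<le> real q * (ln (real q))\<^sup>2 * nint_dist (real q * x) * nint_dist (real q * y)"
proof -
  have "0 < q" using assms(1) by (meson less_le_trans zero_less_numeral zero_less_power)
  then have "(ln 2)\<^sup>2 / 2 ^ 16 = real q * (16 ^ n * (ln 2)\<^sup>2) * threshold n q"
    by (simp add: threshold_def)
  also have "\<dots> \<le> real q * (ln (real q))\<^sup>2 * (nint_dist (q * x) * nint_dist (q * y))"
    using ln_squared_ge[OF assms(1)] assms(2)
    by (intro mult_mono mult_nonneg_nonneg) (auto simp: hyperbolic_set_def threshold_def)
  finally show ?thesis by (simp add: mult.assoc)
qed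

lemma liminf_pos_if_eventually_notin_bad:
  assumes "\<forall>\<^sub>F n in sequentially. (x, y) \<notin> bad n"
  shows "0 < liminf (\<lambda>q::nat. ereal (real q * (ln (real q))\<^sup>2
      * nint_dist (real q * x) * nint_dist (real q * y)))"
    (is "0 < liminf (\<lambda>q. ereal (?f q))")
proof -
  obtain k where k: "\<And>n. k \<le> n \<Longrightarrow> (x, y) \<notin> bad n"
    using assms by (auto simp: eventually_sequentially)
  have "(ln 2)\<^sup>2 / 2 ^ 16 \<le> ?f q" if large: "2 ^ 4 ^ k \<le> q" for q
  proof -
    obtain n where n: "k \<le> n" "2 ^ 4 ^ n \<le> q" "q < 2 ^ 4 ^ Suc n" using ex_stage[OF large] by blast
    then show ?thesis
      using k[of n] by (intro product_ge_if_notin_hyperbolic_set[of n]) (auto simp: bad_def)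
  qed
  then have "\<forall>\<^sub>F q in sequentially. ereal ((ln 2)\<^sup>2 / 2 ^ 16) \<le> ereal (?f q)"
    unfolding eventually_sequentially ereal_less_eq by blast
  then have "ereal ((ln 2)\<^sup>2 / 2 ^ 16) \<le> liminf (\<lambda>q. ereal (?f q))" by (rule Liminf_bounded)
  moreover have "0 < ereal ((ln 2)\<^sup>2 / 2 ^ 16)" by simp
  ultimately show ?thesis by (rule less_le_trans[rotated])
qed

theorem theorem2:
  shows "hausdorff_dim
           {(\<alpha>::real, \<beta>::real).
              liminf (\<lambda>q::nat. ereal (real q * (ln (real q))\<^sup>2
                                      * nint_dist (real q * \<alpha>) * nint_dist (real q * \<beta>))) > 0}
         = 2"
    (is "hausdorff_dim ?E = 2")
proof (rule hausdorff_dim_eqI)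
  show "hausdorff_measure s ?E = 0" if "2 < s" for s
    using that by (intro hausdorff_measure_eq_0_euclidean) simp
  show "hausdorff_measure s ?E \<noteq> 0" if "s < 2" for s
  proof -
    have "\<forall>\<^sub>F n in sequentially. meets_sparsely (1 / 8) (dyadic.side (Suc (Suc n)))
        (dyadic.ratio n (Suc (Suc n))) (bad (Suc (Suc n)))"
      using eventually_ge_at_top[of 1] by eventually_elim (simp add: meets_sparsely_bad)
    then have "hausdorff_measure s {z. \<forall>\<^sub>F n in sequentially. z \<notin> bad n} \<noteq> 0"
      using that by (intro dyadic.hausdorff_measure_eventually_notin_neq_0 eventually_power_le_pow_level)
    moreover have "{z. \<forall>\<^sub>F n in sequentially. z \<notin> bad n} \<subseteq> ?E"
      using liminf_pos_if_eventually_notin_bad by auto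
    ultimately show ?thesis using hausdorff_measure_eq_0_subset by blast
  qed
qed simp

end
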